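(* If $\mathsf{M}$ is a sparse paving matroid of rank $2$, then $\mathsf{M}$ is Ehrhart positive.
   Context: For a matroid $\mathsf{M}$ on $E=\{1,\ldots,n\}$ with set of bases $\mathscr{B}$, the base polytope is $\mathscr{P}(\mathsf{M})=\operatorname{conv}\{e_B : B\in\mathscr{B}\}\subseteq\mathbb{R}^n$, where $e_B=\sum_{i\in B}e_i$. The Ehrhart polynomial $\operatorname{ehr}(\mathsf{M},t)$ is the polynomial of degree $\dim\mathscr{P}(\mathsf{M})$ with $\operatorname{ehr}(\mathsf{M},t)=\#(t\mathscr{P}(\mathsf{M})\cap\mathbb{Z}^n)$ for all nonnegative integers $t$. The matroid $\mathsf{M}$ is Ehrhart positive if all coefficients of $\operatorname{ehr}(\mathsf{M},t)$ (in degrees $0,\ldots,\dim\mathscr{P}(\mathsf{M})$) are positive. A matroid of rank $k$ is paving if every circuit has cardinality at least $k$; it is sparse paving if both it and its dual are paving. *)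

theory Defs
  imports "HOL-Analysis.Analysis" "HOL-Computational_Algebra.Polynomial"
begin

locale matroid =
  fixes E :: "'a set" and \<B> :: "'a set set"
  assumes finite_ground: "finite E"
    and bases_subset: "B \<in> \<B> \<Longrightarrow> B \<subseteq> E"
    and bases_nonempty: "\<B> \<noteq> {}"
    and exchange: "\<lbrakk>A \<in> \<B>; B \<in> \<B>; a \<in> A - B\<rbrakk> \<Longrightarrow> \<exists>b\<in>B - A. insert b (A - {a}) \<in> \<B>"

definition matroid_indep :: "'a set set \<Rightarrow> 'a set \<Rightarrow> bool" where
  "matroid_indep \<B> I \<longleftrightarrow> (\<exists>B\<in>\<B>. I \<subseteq> B)"

definition matroid_circuit :: "'a set \<Rightarrow> 'a set set \<Rightarrow> 'a set \<Rightarrow> bool" where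
  "matroid_circuit E \<B> C \<longleftrightarrow>
     C \<subseteq> E \<and> \<not> matroid_indep \<B> C \<and> (\<forall>D. D \<subset> C \<longrightarrow> matroid_indep \<B> D)"

text \<open>The maximum is over a singleton, see \<open>matroid_rank_eq\<close> below.\<close>

definition matroid_rank :: "'a set set \<Rightarrow> nat" where
  "matroid_rank \<B> = Max (card ` \<B>)"

definition dual_bases :: "'a set \<Rightarrow> 'a set set \<Rightarrow> 'a set set" where
  "dual_bases E \<B> = (\<lambda>B. E - B) ` \<B>"

definition paving :: "'a set \<Rightarrow> 'a set set \<Rightarrow> bool" where
  "paving E \<B> \<longleftrightarrow> (\<forall>C. matroid_circuit E \<B> C \<longrightarrow> matroid_rank \<B> \<le> card C)"

definition sparse_paving :: "'a set \<Rightarrow> 'a set set \<Rightarrow> bool" where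
  "sparse_paving E \<B> \<longleftrightarrow> paving E \<B> \<and> paving E (dual_bases E \<B>)"

context matroid
begin

lemma card_base_le:
  assumes "A \<in> \<B>" "B \<in> \<B>"
  shows "card A \<le> card B"
  using assms(1)
proof (induction "card (A - B)" arbitrary: A rule: less_induct)
  case less
  have fin: "finite A" "finite B"
    using less.prems assms(2) bases_subset finite_ground finite_subset by blast+
  show ?case
  proof (cases "A \<subseteq> B")
    case True
    then show ?thesis using fin by (simp add: card_mono)
  next
    case False
    then obtain a where a: "a \<in> A - B" by blast
    then obtain b where b: "b \<in> B - A" and mem: "insert b (A - {a}) \<in> \<B>"
      using exchange less.prems assms(2) by blast
    have "insert b (A - {a}) - B \<subset> A - B"
    proof (rule psubsetI)
      show "insert b (A - {a}) - B \<subseteq> A - B" using b by auto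
      have "a \<notin> insert b (A - {a}) - B" using a b by auto
      with a show "insert b (A - {a}) - B \<noteq> A - B" by metis
    qed
    then have "card (insert b (A - {a}) - B) < card (A - B)"
      using fin by (simp add: psubset_card_mono)
    then have "card (insert b (A - {a})) \<le> card B" using less.hyps mem by blast
    moreover have "card (insert b (A - {a})) = card A"
    proof -
      have "card (insert b (A - {a})) = Suc (card (A - {a}))"
        using b fin by (subst card_insert_disjoint) auto
      also have "\<dots> = card A"
        using a fin by (intro card_Suc_Diff1) auto
      finally show ?thesis .
    qed
    ultimately show ?thesis by simp
  qed
qed

lemma matroid_rank_eq:
  assumes "B \<in> \<B>"
  shows "matroid_rank \<B> = card B"
proof -
  have "card A = card B" if "A \<in> \<B>" for A
    using card_base_le[OF that assms] card_base_le[OF assms that] by (rule le_antisym)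
  then have "card ` \<B> \<subseteq> {card B}" by blast
  with assms have "card ` \<B> = {card B}" by blast
  then show ?thesis by (simp add: matroid_rank_def)
qed

end

text \<open>The ground set is an arbitrary nonempty finite type \<open>'n\<close>, so that the ambient
  space is \<open>real ^ 'n\<close>.\<close>

definition base_polytope :: "'n::finite set set \<Rightarrow> (real ^ 'n) set" where
  "base_polytope \<B> = convex hull ((\<lambda>B. \<Sum>i\<in>B. axis i 1) ` \<B>)"

definition integer_points :: "(real ^ 'n::finite) set" where
  "integer_points = {x. \<forall>i. x $ i \<in> \<int>}"

definition is_ehrhart_poly :: "(real ^ 'n::finite) set \<Rightarrow> real poly \<Rightarrow> bool" where
  "is_ehrhart_poly P p \<longleftrightarrow>
     int (degree p) = aff_dim P \<and>
     (\<forall>t::nat. poly p (real t) = real (card ((\<lambda>x. real t *\<^sub>R x) ` P \<inter> integer_points)))"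

lemma is_ehrhart_poly_unique:
  assumes "is_ehrhart_poly P p" "is_ehrhart_poly P q"
  shows "p = q"
proof (rule ccontr)
  assume "p \<noteq> q"
  then have "finite {x. poly (p - q) x = 0}" by (intro poly_roots_finite) simp
  moreover have "range real \<subseteq> {x. poly (p - q) x = 0}"
    using assms by (auto simp: is_ehrhart_poly_def)
  ultimately have "finite (range real)" by (rule rev_finite_subset)
  then show False by (simp add: finite_image_iff inj_on_def)
qed

definition ehrhart_poly :: "'n::finite set set \<Rightarrow> real poly" where
  "ehrhart_poly \<B> = (THE p. is_ehrhart_poly (base_polytope \<B>) p)"

lemma ehrhart_poly_eqI:
  "is_ehrhart_poly (base_polytope \<B>) p \<Longrightarrow> ehrhart_poly \<B> = p"
  unfolding ehrhart_poly_def by (blast intro: is_ehrhart_poly_unique)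

text \<open>The first conjunct makes Ehrhart positivity independent of the value that
  \<open>THE\<close> would take if no Ehrhart polynomial existed.\<close>

definition ehrhart_positive :: "'n::finite set set \<Rightarrow> bool" where
  "ehrhart_positive \<B> \<longleftrightarrow>
     is_ehrhart_poly (base_polytope \<B>) (ehrhart_poly \<B>) \<and>
     (\<forall>i. int i \<le> aff_dim (base_polytope \<B>) \<longrightarrow> coeff (ehrhart_poly \<B>) i > 0)"

end

theory Submission
  imports Defs
begin

text \<open>
  A sparse paving matroid of rank 2 on \<open>n\<close> elements has no loops, and its parallel classes have one or
  two elements; let \<open>l\<close> be the number of the latter. The lattice points of the \<open>t\<close>-th dilation of the
  base polytope are the nonnegative integer vectors of total \<open>2t\<close> in which every class sum is at most
  \<open>t\<close>. At most one class sum can exceed \<open>t\<close>, so inclusion-exclusion needs only one step and the number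
  of lattice points is
  \<open>C(2t+n-1, n-1) - (n-l) C(t+n-2, n-1) - l (t+1) C(t+n-3, n-2)\<close>.
  As \<open>l \<le> n/2\<close>, it suffices to treat \<open>l = n/2\<close>. Multiplying by \<open>(n-1)!\<close> gives a polynomial \<open>H\<^sub>n\<close>, and
  \<open>H\<close> at \<open>n+1\<close> is \<open>(2t+n) H\<^sub>n\<close> plus the rising factorial of \<open>t\<close> times a quadratic with nonnegative
  coefficients, so positivity follows by induction from \<open>n = 5\<close>.
\<close>

subsection \<open>Positivity of the coefficients\<close>

lemma poly_pochhammer: "poly (pochhammer p k) x = pochhammer (poly p x) k"
  for p :: "'a::comm_semiring_1 poly"
  by (induction k) (simp_all add: pochhammer_Suc)

lemma coeff_mult_nonneg:
  fixes p q :: "'a::linordered_idom poly"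
  assumes "\<And>i. 0 \<le> coeff p i" "\<And>i. 0 \<le> coeff q i"
  shows "0 \<le> coeff (p * q) i"
  by (simp add: coeff_mult assms sum_nonneg)

lemma coeff_pochhammer_nonneg: "0 \<le> coeff (pochhammer [:0, 1:] k :: real poly) i"
proof (induction k arbitrary: i)
  case 0
  then show ?case by (simp add: coeff_1)
next
  case (Suc k)
  have "0 \<le> coeff ([:0, 1:] + of_nat k :: real poly) i" for i
    by (simp add: of_nat_poly coeff_pCons split: nat.split)
  with Suc show ?case by (simp add: pochhammer_Suc coeff_mult_nonneg)
qed

lemma degree_pochhammer_le: "degree p \<le> 1 \<Longrightarrow> degree (pochhammer p k) \<le> k"
  for p :: "'a::comm_semiring_1 poly"
proof (induction k)
  case (Suc k)
  have "degree (p + of_nat k) \<le> 1"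
    using Suc.prems by (intro degree_add_le) auto
  then show ?case
    using degree_mult_le[of "pochhammer p k" "p + of_nat k"] Suc by (simp add: pochhammer_Suc)
qed simp

text \<open>For \<open>n = m + 2\<close> elements and \<open>l\<close> two-element parallel classes this is \<open>(n - 1)!\<close> times the
  Ehrhart polynomial.\<close>

definition scaled_ehrhart :: "nat \<Rightarrow> real \<Rightarrow> real poly" where
  "scaled_ehrhart m l = pochhammer [:1, 2:] (Suc m)
     - pochhammer [:0, 1:] m * [:real m * (real m + 2) + l, real m + 2 + l * real m:]"

lemma degree_scaled_ehrhart: "degree (scaled_ehrhart m l) \<le> Suc m"
proof -
  let ?q = "[:real m * (real m + 2) + l, real m + 2 + l * real m:]"
  have "degree (pochhammer [:0, 1:] m * ?q) \<le> m + degree ?q"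
    by (rule order_trans[OF degree_mult_le]) (simp add: degree_pochhammer_le)
  also have "\<dots> \<le> Suc m"
    by (simp add: degree_pCons_le)
  finally show ?thesis
    unfolding scaled_ehrhart_def
    by (intro degree_diff_le) (auto intro!: degree_pochhammer_le)
qed

lemma poly_scaled_ehrhart:
  "poly (scaled_ehrhart m l) x = pochhammer (2 * x + 1) (Suc m)
     - pochhammer x m * ((real m + 2) * (x + real m) + l * (real m * x + 1))"
  by (simp add: scaled_ehrhart_def poly_pochhammer algebra_simps)

text \<open>The coefficients decrease in \<open>l\<close>, so \<open>l = n / 2\<close> is the extremal case.\<close>

lemma scaled_ehrhart_half_Suc:
  fixes m :: nat
  defines "n \<equiv> real m + 2"
  shows "scaled_ehrhart (Suc m) ((n + 1) / 2) = [:n, 2:] * scaled_ehrhart m (n / 2)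
    + pochhammer [:0, 1:] m * smult (1/2) [:3 * n - 2, 2 * n^2 - 4 * n + 3, 2 * n^2 - (n + 1)^2:]"
proof (rule poly_eq_poly_eq_iff[THEN iffD1], rule ext)
  fix x
  have a: "pochhammer (2 * x + 1) (Suc (Suc m)) = pochhammer (2 * x + 1) (Suc m) * (2 * x + n)"
    "pochhammer x (Suc m) = pochhammer x m * (x + n - 2)"
    by (simp_all add: pochhammer_Suc n_def algebra_simps)
  have m: "real m = n - 2" by (simp add: n_def)
  show "poly (scaled_ehrhart (Suc m) ((n + 1) / 2)) x = poly ([:n, 2:] * scaled_ehrhart m (n / 2)
    + pochhammer [:0, 1:] m * smult (1/2) [:3 * n - 2, 2 * n^2 - 4 * n + 3, 2 * n^2 - (n + 1)^2:]) x"
    by (simp add: poly_scaled_ehrhart poly_pochhammer a m) (simp add: field_simps power2_eq_square)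
qed


text \<open>The claim fails at \<open>m = 2\<close>, where the top coefficient
  \<open>2^(m+1) - (m + 2) - l * m\<close> vanishes for \<open>l = 2\<close>, so the induction
  starts at \<open>m = 3\<close>. Nonnegativity in every degree is carried along because the
  recursion reads one degree past the top.\<close>

lemma scaled_ehrhart_half_pos:
  assumes "3 \<le> m"
  shows "(\<forall>i. 0 \<le> coeff (scaled_ehrhart m ((real m + 2) / 2)) i) \<and>
    (\<forall>i\<le>Suc m. 0 < coeff (scaled_ehrhart m ((real m + 2) / 2)) i)"
  using assms
proof (induction m rule: nat_induct_at_least)
  case base
  have "scaled_ehrhart 3 ((real 3 + 2) / 2) = [:24, 65, 125/2, 25, 7/2:]"
    by (simp add: scaled_ehrhart_def pochhammer_Suc numeral_eq_Suc of_nat_poly)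
  then show ?case
    by (auto simp: coeff_pCons numeral_eq_Suc split: nat.split)
next
  case (Suc m)
  define n where "n = real m + 2"
  define H where "H = scaled_ehrhart m (n / 2)"
  define q where "q = smult (1/2) [:3 * n - 2, 2 * n^2 - 4 * n + 3, 2 * n^2 - (n + 1)^2:]"
  have n: "5 \<le> n" using Suc.hyps by (simp add: n_def)
  have H: "0 \<le> coeff H i" "i \<le> Suc m \<Longrightarrow> 0 < coeff H i" for i
    using Suc.IH by (simp_all add: H_def n_def)
  have "5 * n \<le> n^2"
    using n by (simp add: power2_eq_square)
  moreover have "(n + 1)^2 = n^2 + 2 * n + 1"
    by (simp add: power2_eq_square algebra_simps)
  ultimately have "0 \<le> 2 * n^2 - 4 * n + 3" "0 \<le> 2 * n^2 - (n + 1)^2"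
    using n by linarith+
  then have "0 \<le> coeff q i" for i
    using n by (auto simp: q_def coeff_pCons split: nat.split)
  then have q: "0 \<le> coeff (pochhammer [:0, 1:] m * q) i" for i
    by (intro coeff_mult_nonneg coeff_pochhammer_nonneg)
  have eq: "scaled_ehrhart (Suc m) ((real (Suc m) + 2) / 2) = [:n, 2:] * H + pochhammer [:0, 1:] m * q"
    using scaled_ehrhart_half_Suc[of m] by (simp add: n_def H_def q_def add_ac)
  have lin: "coeff ([:n, 2:] * H) i = n * coeff H i + (case i of 0 \<Rightarrow> 0 | Suc j \<Rightarrow> 2 * coeff H j)" for i
    by (simp add: coeff_pCons split: nat.split)
  have "0 \<le> coeff ([:n, 2:] * H) i" for i
    using n H(1) unfolding lin by (auto split: nat.split)
  \<comment> \<open>For \<open>i = Suc j\<close> positivity comes from \<open>2 * coeff H j\<close>,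
    since \<open>coeff H i\<close> may vanish at the top; for \<open>i = 0\<close> it comes from
    \<open>n * coeff H 0\<close>.\<close>
  moreover have "0 < coeff ([:n, 2:] * H) i" if "i \<le> Suc (Suc m)" for i
    using n H that unfolding lin
    by (cases i) (auto intro!: add_nonneg_pos)
  ultimately show ?case
    using q unfolding eq coeff_add by (auto intro: add_pos_nonneg add_nonneg_nonneg)
qed

text \<open>Here \<open>d\<close> anticipates the dimension of the polytope: \<open>l = m\<close>
  means exactly two parallel classes, and one dimension is lost. The hypotheses allow this only for
  \<open>m <= 2\<close>, where all pairs are checked directly; larger \<open>m\<close> reduce to the
  extremal \<open>l\<close>.\<close>

lemma scaled_ehrhart_pos:
  fixes m l :: nat
  assumes "2 * l \<le> m + 2" "l \<le> m"
  defines "d \<equiv> if l < m then Suc m else m"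
  shows "degree (scaled_ehrhart m l) = d" (is ?deg)
    and "i \<le> d \<Longrightarrow> 0 < coeff (scaled_ehrhart m l) i"
proof -
  have "?deg \<and> (\<forall>i\<le>d. 0 < coeff (scaled_ehrhart m l) i)"
  proof (cases "3 \<le> m")
    case True
    then have d: "d = Suc m" using assms by simp
    let ?h = "(real m + 2) / 2"
    let ?r = "pochhammer [:0, 1:] m * smult (?h - l) [:1, real m:]"
    \<comment> \<open>Lowering \<open>l\<close> from its extremal value \<open>?h\<close> adds a
      rising factorial times a linear factor, both with nonnegative coefficients.\<close>
    have eq: "scaled_ehrhart m l = scaled_ehrhart m ?h + ?r"
      by (rule poly_eq_poly_eq_iff[THEN iffD1], rule ext)
         (simp add: poly_scaled_ehrhart poly_pochhammer algebra_simps add_divide_distrib)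
    have "2 * real l \<le> real m + 2"
      using assms(1) by linarith
    then have "0 \<le> coeff (smult (?h - l) [:1, real m:]) i" for i
      by (auto simp: coeff_pCons split: nat.split)
    then have "0 \<le> coeff ?r i" for i
      by (intro coeff_mult_nonneg coeff_pochhammer_nonneg)
    then have pos: "\<forall>i\<le>Suc m. 0 < coeff (scaled_ehrhart m l) i"
      using scaled_ehrhart_half_pos[OF True] by (simp add: eq add_pos_nonneg)
    moreover have "degree (scaled_ehrhart m l) = Suc m"
      using pos by (intro antisym degree_scaled_ehrhart le_degree) (simp add: less_imp_neq[symmetric])
    ultimately show ?thesis by (simp add: d)
  next
    case False
    with assms consider "m = 0" "l = 0" | "m = 1" "l = 0" | "m = 1" "l = 1"
      | "m = 2" "l = 0" | "m = 2" "l = 1" | "m = 2" "l = 2"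
      by linarith
    then show ?thesis
      by cases (auto simp: d_def scaled_ehrhart_def pochhammer_Suc numeral_eq_Suc of_nat_poly
        coeff_pCons split: nat.split)
  qed
  then show ?deg "i \<le> d \<Longrightarrow> 0 < coeff (scaled_ehrhart m l) i" by auto
qed

subsection \<open>Weak compositions\<close>

text \<open>The value 0 outside \<open>A\<close> makes each composition a single function on the
  whole type, so that these sets have the expected cardinality.\<close>

definition compositions :: "'a set \<Rightarrow> nat \<Rightarrow> ('a \<Rightarrow> nat) set" where
  "compositions A s = {f. (\<forall>x. x \<notin> A \<longrightarrow> f x = 0) \<and> sum f A = s}"

lemma finite_compositions:
  assumes "finite A" shows "finite (compositions A s)"
proof (rule finite_subset)
  show "compositions A s \<subseteq> {f. \<forall>x. (x \<in> A \<longrightarrow> f x \<in> {..s}) \<and> (x \<notin> A \<longrightarrow> f x = 0)}"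
    using assms by (auto simp: compositions_def member_le_sum)
  show "finite {f :: 'a \<Rightarrow> nat. \<forall>x. (x \<in> A \<longrightarrow> f x \<in> {..s}) \<and> (x \<notin> A \<longrightarrow> f x = 0)}"
    using assms by (intro finite_set_of_finite_funs) auto
qed

lemma bij_betw_compositions_shift:
  assumes "finite A" "a \<in> A"
  shows "bij_betw (\<lambda>f. f(a := f a + m)) (compositions A s) {f \<in> compositions A (s + m). m \<le> f a}"
proof (rule bij_betw_byWitness[where f' = "\<lambda>f. f(a := f a - m)"])
  have upd: "sum (f(a := k)) A + f a = sum f A + k" for f :: "'a \<Rightarrow> nat" and k
  proof -
    have "sum (f(a := k)) (A - {a}) = sum f (A - {a})" by (intro sum.cong) auto
    with assms show ?thesis
      by (simp add: sum.remove[of A a f] sum.remove[of A a "f(a := k)"] del: fun_upd_apply)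
         (simp add: fun_upd_same)
  qed
  show "(\<lambda>f. f(a := f a + m)) ` compositions A s \<subseteq> {f \<in> compositions A (s + m). m \<le> f a}"
  proof clarify
    fix f assume "f \<in> compositions A s"
    then show "f(a := f a + m) \<in> compositions A (s + m) \<and> m \<le> (f(a := f a + m)) a"
      using upd[of f "f a + m"] assms by (auto simp: compositions_def)
  qed
  show "(\<lambda>f. f(a := f a - m)) ` {f \<in> compositions A (s + m). m \<le> f a} \<subseteq> compositions A s"
  proof clarify
    fix f assume "f \<in> compositions A (s + m)" "m \<le> f a"
    then show "f(a := f a - m) \<in> compositions A s"
      using upd[of f "f a - m"] assms by (auto simp: compositions_def)
  qed
qed auto

lemma bij_betw_compositions_slice:
  assumes "finite A" "a \<in> A"
  shows "bij_betw (\<lambda>f. f(a := k)) (compositions (A - {a}) s) {f \<in> compositions A (s + k). f a = k}"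
proof (rule bij_betw_byWitness[where f' = "\<lambda>f. f(a := 0)"])
  have upd: "sum (f(a := k)) A = sum f (A - {a}) + k" for f :: "'a \<Rightarrow> nat" and k
  proof -
    have "sum (f(a := k)) (A - {a}) = sum f (A - {a})" by (intro sum.cong) auto
    with assms show ?thesis by (simp add: sum.remove[of A a "f(a := k)"] del: fun_upd_apply) simp
  qed
  show "(\<lambda>f. f(a := k)) ` compositions (A - {a}) s \<subseteq> {f \<in> compositions A (s + k). f a = k}"
    using upd assms by (auto simp: compositions_def)
  show "(\<lambda>f. f(a := 0)) ` {f \<in> compositions A (s + k). f a = k} \<subseteq> compositions (A - {a}) s"
  proof clarify
    fix f assume f: "f \<in> compositions A (s + f a)"
    have "sum (f(a := 0)) (A - {a}) = sum f (A - {a})" by (intro sum.cong) auto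
    then show "f(a := 0) \<in> compositions (A - {a}) s"
      using upd[of f "f a"] f by (auto simp: compositions_def)
  qed
qed (auto simp: compositions_def)

text \<open>Stars and bars, by Pascal's rule: either \<open>f a = 0\<close>, which drops
  \<open>a\<close>, or one unit can be removed at \<open>a\<close>. The lower index \<open>s\<close>
  keeps the formula valid for empty \<open>A\<close> despite truncated subtraction.\<close>

lemma card_compositions:
  assumes "finite A"
  shows "card (compositions A s) = (s + card A - 1) choose s"
  using assms
proof (induction A arbitrary: s rule: finite_induct)
  case empty
  have "(compositions {} s :: ('a \<Rightarrow> nat) set) = (if s = 0 then {\<lambda>_. 0} else {})"
    by (auto simp: compositions_def)
  then show ?case by (cases s) simp_all
next
  case (insert a A)
  show ?case
  proof (induction s)
    case 0
    have "compositions (insert a A) 0 = {\<lambda>_. 0}"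
      using insert.hyps by (auto simp: compositions_def fun_eq_iff) metis
    then show ?case by simp
  next
    case (Suc s)
    let ?C = "compositions (insert a A) (Suc s)"
    have "?C = {f \<in> ?C. f a = 0} \<union> {f \<in> ?C. 1 \<le> f a}" by force
    then have "card ?C = card ({f \<in> ?C. f a = 0} \<union> {f \<in> ?C. 1 \<le> f a})" by metis
    also have "\<dots> = card {f \<in> ?C. f a = 0} + card {f \<in> ?C. 1 \<le> f a}"
      using finite_compositions[of "insert a A" "Suc s"] insert.hyps
      by (intro card_Un_disjoint) auto
    also have "card {f \<in> ?C. f a = 0} = (Suc s + card A - 1) choose Suc s"
      using bij_betw_same_card[OF bij_betw_compositions_slice[of "insert a A" a 0 "Suc s"]]
        insert.hyps insert.IH by simp
    also have "card {f \<in> ?C. 1 \<le> f a} = (s + card (insert a A) - 1) choose s"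
      using bij_betw_same_card[OF bij_betw_compositions_shift[of "insert a A" a 1 s]]
        insert.hyps Suc by simp
    finally show ?case using insert.hyps by simp
  qed
qed

text \<open>For positive \<open>t\<close>, removing \<open>m\<close> at \<open>a\<close> leaves the
  total \<open>t - 1\<close>. The form \<open>s + 1 = m + t\<close> also admits
  \<open>t = 0\<close>, where \<open>m\<close> exceeds the total and both sides are 0.\<close>

lemma card_compositions_ge:
  assumes "finite A" "a \<in> A" "2 \<le> card A" "s + 1 = m + t"
  shows "card {f \<in> compositions A s. m \<le> f a} = (t + card A - 2) choose (card A - 1)"
proof (cases t)
  case 0
  have "f a \<le> s" if "f \<in> compositions A s" for f
    using that assms member_le_sum[of a A f] by (auto simp: compositions_def)
  then have "{f \<in> compositions A s. m \<le> f a} = {}"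
    using 0 assms by fastforce
  then have "card {f \<in> compositions A s. m \<le> f a} = 0" by (metis card.empty)
  then show ?thesis using 0 assms by simp
next
  case (Suc r)
  then have "card {f \<in> compositions A s. m \<le> f a} = card (compositions A r)"
    using bij_betw_same_card[OF bij_betw_compositions_shift[of A a m r]] assms by (simp add: add.commute)
  also have "\<dots> = (r + card A - 1) choose (card A - 1)"
    using assms binomial_symmetric[of r "r + card A - 1"] by (simp add: card_compositions)
  finally show ?thesis using Suc assms by simp
qed

text \<open>Either \<open>f i > t\<close> already, or \<open>f i = a\<close> with
  \<open>a <= t\<close>. In the second case fixing and deleting coordinate \<open>i\<close> leaves a
  count that does not depend on \<open>a\<close>, whence the factor \<open>t + 1\<close>.\<close>

lemma card_compositions_pair_gt:
  assumes "finite A" "i \<in> A" "j \<in> A" "i \<noteq> j" "3 \<le> card A"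
  shows "card {f \<in> compositions A (2 * t). t < f i + f j} =
    ((t + card A - 2) choose (card A - 1)) + (t + 1) * ((t + card A - 3) choose (card A - 2))"
proof -
  let ?C = "compositions A (2 * t)"
  let ?S = "\<lambda>a. {f \<in> ?C. f i = a \<and> t + 1 - a \<le> f j}"
  have fin: "finite ?C" using assms(1) by (rule finite_compositions)
  have "card (?S a) = (t + card A - 3) choose (card A - 2)" if "a \<le> t" for a
  proof -
    let ?D = "compositions (A - {i}) (2 * t - a)"
    let ?h = "\<lambda>f. f(i := a)"
    have bij: "bij_betw ?h ?D {f \<in> ?C. f i = a}"
      using bij_betw_compositions_slice[of A i a "2 * t - a"] assms that by simp
    have "bij_betw ?h {f \<in> ?D. t + 1 - a \<le> f j} (?S a)"
    proof (rule bij_betw_subset[OF bij])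
      have "?h ` {f \<in> ?D. t + 1 - a \<le> f j} = {f \<in> ?h ` ?D. t + 1 - a \<le> f j}"
        using assms(4) by force
      also have "?h ` ?D = {f \<in> ?C. f i = a}"
        using bij by (rule bij_betw_imp_surj_on)
      finally show "?h ` {f \<in> ?D. t + 1 - a \<le> f j} = ?S a"
        by (simp only: mem_Collect_eq conj_assoc)
    qed auto
    then have "card (?S a) = card {f \<in> ?D. t + 1 - a \<le> f j}"
      by (simp add: bij_betw_same_card)
    \<comment> \<open>The total \<open>2 * t - a\<close> and the bound \<open>t + 1 - a\<close>
      shift together, so the parameter is \<open>t\<close> for every \<open>a\<close>.\<close>
    also have "\<dots> = (t + card (A - {i}) - 2) choose (card (A - {i}) - 1)"
      using assms that by (intro card_compositions_ge) auto
    finally show ?thesis using assms by (simp add: numeral_eq_Suc)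
  qed
  then have sum_S: "(\<Sum>a\<le>t. card (?S a)) = (t + 1) * ((t + card A - 3) choose (card A - 2))"
    by (subst sum.cong[OF refl]) auto
  have "t + 1 + t = 2 * t + 1" by simp
  then have ge: "card {f \<in> ?C. t + 1 \<le> f i} = (t + card A - 2) choose (card A - 1)"
    using assms by (intro card_compositions_ge) simp_all
  have "{f \<in> ?C. t < f i + f j} = {f \<in> ?C. t + 1 \<le> f i} \<union> (\<Union>a\<le>t. ?S a)"
    by auto
  moreover have "card ({f \<in> ?C. t + 1 \<le> f i} \<union> (\<Union>a\<le>t. ?S a)) =
      card {f \<in> ?C. t + 1 \<le> f i} + card (\<Union>a\<le>t. ?S a)"
    using fin by (intro card_Un_disjoint) auto
  moreover have "card (\<Union>a\<le>t. ?S a) = (\<Sum>a\<le>t. card (?S a))"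
    using fin by (intro card_UN_disjoint) auto
  ultimately show ?thesis
    by (simp only: ge sum_S)
qed

subsection \<open>The polytope of a rank 2 matroid with given parallel classes\<close>

lemma sum_of_bool_eq_card: "finite A \<Longrightarrow> (\<Sum>x\<in>A. of_bool (P x)) = card {x \<in> A. P x}"
  by (simp add: Int_def)

text \<open>Clears denominators in the inclusion-exclusion count: \<open>A\<close>,
  \<open>C\<close>, \<open>D\<close> stand for the binomials, \<open>F\<close> for
  \<open>(m + 1)!\<close>, \<open>P\<close> and \<open>Q\<close> for rising factorials,
  \<open>R\<close> for the number of classes and \<open>L\<close> for the number of lattice
  points.\<close>

lemma count_identity:
  fixes A C D F L P Q R l m t :: real
  assumes "A * F = P * (t + m)" "D * F = Q" "l * (C * F) = l * (P * (m + 1))"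
    and D: "L + R * A + l * ((t + 1) * C) = D" and "R = m + 2 - l"
  shows "F * L = Q - P * ((m + 2) * (t + m) + l * (m * t + 1))"
proof -
  have "F * L = D * F - R * (A * F) - (t + 1) * (l * (C * F))"
    by (simp add: D[symmetric] algebra_simps)
  then show ?thesis
    unfolding assms by (simp add: algebra_simps)
qed

lemma binomial_mult_fact_eq_pochhammer:
  "real ((a + k) choose Suc k) * fact (Suc k) = pochhammer (real a) (Suc k)"
  by (simp add: binomial_gbinomial gbinomial_pochhammer' del: fact_Suc)

text \<open>The edges of the complete multipartite graph on the classes. Different classes force
  \<open>i\<close> and \<open>j\<close> to differ, so every member is a genuine pair.\<close>

definition rank2_bases :: "('n \<Rightarrow> 'n set) \<Rightarrow> 'n set set" where
  "rank2_bases cls = {{i, j} | i j. cls i \<noteq> cls j}"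

lemma sum_axis_nth: "(\<Sum>i\<in>B. axis i (1::real)) $ k = of_bool (k \<in> B)"
  for B :: "'n::finite set"
  by (simp add: sum_component axis_def)

text \<open>A partition, encoded by the map from an element to its block; \<open>range cls\<close>
  is the set of blocks.\<close>

locale parallel_classes =
  fixes cls :: "'n::finite \<Rightarrow> 'n set"
  assumes mem_cls_iff: "j \<in> cls i \<longleftrightarrow> cls j = cls i"
begin

lemma cls_eq: "v \<in> range cls \<Longrightarrow> j \<in> v \<Longrightarrow> cls j = v"
  by (auto simp: mem_cls_iff)

lemma self_mem_cls: "i \<in> cls i"
  by (simp add: mem_cls_iff)

lemma sum_classes: "(\<Sum>v\<in>range cls. sum f v) = sum f UNIV"
  for f :: "'n \<Rightarrow> 'b::comm_monoid_add"
proof -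
  have fibre: "{j. cls j = v} = v" if v: "v \<in> range cls" for v
  proof -
    obtain i where i: "v = cls i" using v by blast
    show ?thesis by (rule set_eqI) (simp add: i mem_cls_iff)
  qed
  have "(\<Sum>v\<in>range cls. sum f {j \<in> UNIV. cls j = v}) = sum f UNIV"
    using sum.group[of UNIV "range cls" cls f] by simp
  moreover have "(\<Sum>v\<in>range cls. sum f {j \<in> UNIV. cls j = v}) = (\<Sum>v\<in>range cls. sum f v)"
    by (rule sum.cong) (simp_all only: UNIV_I simp_thms fibre)
  ultimately show ?thesis by (simp only:)
qed

section \<open>Integer points of the dilations\<close>

definition lattice_points :: "nat \<Rightarrow> ('n \<Rightarrow> nat) set" where
  "lattice_points t = {f \<in> compositions UNIV (2 * t). \<forall>v\<in>range cls. sum f v \<le> t}"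

lemma rank2_basesI: "cls i \<noteq> cls j \<Longrightarrow> {i, j} \<in> rank2_bases cls"
  unfolding rank2_bases_def by blast

text \<open>The constraints cut out a convex set, and each vertex satisfies them because a base
  meets every class at most once.\<close>

lemma base_polytope_constraints:
  assumes "x \<in> base_polytope (rank2_bases cls)"
  shows "0 \<le> x $ i" "(\<Sum>i\<in>UNIV. x $ i) = 2" "v \<in> range cls \<Longrightarrow> (\<Sum>i\<in>v. x $ i) \<le> 1"
proof -
  let ?Q = "{x :: real ^ 'n. (\<forall>i. 0 \<le> x $ i) \<and> (\<Sum>i\<in>UNIV. x $ i) = 2 \<and>
    (\<forall>v\<in>range cls. (\<Sum>i\<in>v. x $ i) \<le> 1)}"
  have "convex ?Q"
  proof (rule convexI)
    fix x y :: "real ^ 'n" and a b :: real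
    assume xy: "x \<in> ?Q" "y \<in> ?Q" and ab: "0 \<le> a" "0 \<le> b" "a + b = 1"
    have sums: "(\<Sum>i\<in>S. (a *\<^sub>R x + b *\<^sub>R y) $ i) = a * (\<Sum>i\<in>S. x $ i) + b * (\<Sum>i\<in>S. y $ i)" for S
      by (simp add: sum.distrib sum_distrib_left)
    have "a * 2 + b * 2 = 2" using ab by simp
    then show "a *\<^sub>R x + b *\<^sub>R y \<in> ?Q"
      using xy ab unfolding mem_Collect_eq sums by (auto intro: convex_bound_le)
  qed
  moreover have "(\<lambda>B. \<Sum>i\<in>B. axis i 1) ` rank2_bases cls \<subseteq> ?Q"
  proof clarify
    fix B assume "B \<in> rank2_bases cls"
    then obtain i j where B: "B = {i, j}" "cls i \<noteq> cls j"
      unfolding rank2_bases_def by blast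
    then have "i \<noteq> j" by auto
    then have nth: "(\<Sum>i\<in>B. axis i (1::real)) $ k = of_bool (k = i) + of_bool (k = j)" for k
      unfolding sum_axis_nth B(1) by simp
    have sums: "(\<Sum>k\<in>S. (\<Sum>i\<in>B. axis i (1::real)) $ k) = of_bool (i \<in> S) + of_bool (j \<in> S)" for S
      unfolding nth by (simp add: sum.distrib of_bool_def)
    have "\<not> (i \<in> v \<and> j \<in> v)" if "v \<in> range cls" for v
      using B(2) cls_eq[OF that] by metis
    then show "(\<forall>k. 0 \<le> (\<Sum>i\<in>B. axis i (1::real)) $ k) \<and> (\<Sum>k\<in>UNIV. (\<Sum>i\<in>B. axis i (1::real)) $ k) = 2 \<and>
      (\<forall>v\<in>range cls. (\<Sum>k\<in>v. (\<Sum>i\<in>B. axis i (1::real)) $ k) \<le> 1)"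
      unfolding sums unfolding nth by (auto simp: of_bool_def)
  qed
  ultimately have "base_polytope (rank2_bases cls) \<subseteq> ?Q"
    unfolding base_polytope_def by (rule hull_minimal[rotated])
  with assms show "0 \<le> x $ i" "(\<Sum>i\<in>UNIV. x $ i) = 2" "v \<in> range cls \<Longrightarrow> (\<Sum>i\<in>v. x $ i) \<le> 1"
    by auto
qed

text \<open>Removing one point from each of the two classes of largest weight keeps all class sums
  at most \<open>t\<close>, since three classes of weight \<open>t + 1\<close> would exceed the total \<open>2 * t + 2\<close>.\<close>

lemma lattice_points_Suc:
  assumes "f \<in> lattice_points (Suc t)"
  obtains i j g where "cls i \<noteq> cls j" "g \<in> lattice_points t"
    "\<forall>k. f k = g k + of_bool (k = i) + of_bool (k = j)"
proof -
  let ?R = "range cls"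
  have total: "(\<Sum>v\<in>?R. sum f v) = 2 * t + 2" and le: "v \<in> ?R \<Longrightarrow> sum f v \<le> t + 1" for v
    using assms by (auto simp: lattice_points_def compositions_def sum_classes)
  have "Max (sum f ` ?R) \<in> sum f ` ?R" by (intro Max_in) auto
  then obtain v where v: "v \<in> ?R" "sum f v = Max (sum f ` ?R)" by fastforce
  have v_max: "sum f w \<le> sum f v" if "w \<in> ?R" for w
    using v that by simp
  have rest: "(\<Sum>w\<in>?R - {v}. sum f w) + sum f v = 2 * t + 2"
    using v(1) total sum.remove[of ?R v "sum f"] by simp
  \<comment> \<open>The class \<open>v\<close> carries at most \<open>t + 1\<close>, less than the
    total, so a second class of positive weight exists.\<close>
  then have "(\<Sum>w\<in>?R - {v}. sum f w) \<noteq> 0"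
    using le[OF v(1)] by linarith
  then have ne: "?R - {v} \<noteq> {}" by (metis sum.empty)
  have "Max (sum f ` (?R - {v})) \<in> sum f ` (?R - {v})" by (intro Max_in) (use ne in auto)
  then obtain w where w: "w \<in> ?R - {v}" "sum f w = Max (sum f ` (?R - {v}))" by fastforce
  have w_max: "sum f u \<le> sum f w" if "u \<in> ?R - {v}" for u
    unfolding w(2) by (intro Max_ge) (use that in auto)
  have w_pos: "sum f w \<noteq> 0"
  proof
    assume "sum f w = 0"
    then have "(\<Sum>u\<in>?R - {v}. sum f u) = 0" using w_max by (intro sum.neutral) fastforce
    with \<open>(\<Sum>w\<in>?R - {v}. sum f w) \<noteq> 0\<close> show False by simp
  qed
  have "sum f w \<le> sum f v" using v_max w(1) by blast
  then have "sum f v \<noteq> 0" using w_pos by linarith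
  then obtain i where i: "i \<in> v" "f i \<noteq> 0" by (meson sum.neutral)
  obtain j where j: "j \<in> w" "f j \<noteq> 0" using w_pos by (meson sum.neutral)
  have "cls i = v" using v(1) i(1) by (rule cls_eq)
  moreover have "cls j = w" using w(1) j(1) by (intro cls_eq) auto
  ultimately have ij: "cls i \<noteq> cls j" using w(1) by auto
  \<comment> \<open>The subtraction does not truncate: \<open>f i\<close> and \<open>f j\<close> are
    nonzero and \<open>i\<close>, \<open>j\<close> are distinct.\<close>
  define g where "g k = f k - of_bool (k = i) - of_bool (k = j)" for k
  have fg: "f k = g k + of_bool (k = i) + of_bool (k = j)" for k
    using i j ij by (auto simp: g_def)
  have sums: "sum f S = sum g S + of_bool (i \<in> S) + of_bool (j \<in> S)" for S
    by (simp add: fg sum.distrib of_bool_def)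
  have "sum g u \<le> t" if u: "u \<in> ?R" for u
  proof (cases "u = v \<or> u = w")
    case True
    then show ?thesis using sums[of u] i(1) j(1) le[OF u] by auto
  next
    case False
    have "sum f u + (\<Sum>x\<in>?R - {v} - {w} - {u}. sum f x) + sum f w = (\<Sum>x\<in>?R - {v}. sum f x)"
      using False u w(1) sum.remove[of "?R - {v}" w "sum f"] sum.remove[of "?R - {v} - {w}" u "sum f"]
      by simp
    with rest have "sum f u + sum f w + sum f v \<le> 2 * t + 2" by linarith
    moreover have "sum f u \<le> sum f w" "sum f u \<le> sum f v"
      by (intro v_max w_max; use False u in blast)+
    ultimately have "sum f u \<le> t" by linarith
    then show ?thesis using sums[of u] by linarith
  qed
  moreover have "sum g UNIV = 2 * t"
    using sums[of UNIV] total by (simp add: sum_classes)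
  ultimately have "g \<in> lattice_points t"
    by (simp add: lattice_points_def compositions_def)
  then show thesis by (rule that[OF ij _ allI[OF fg]])
qed

text \<open>The integer decomposition property: peeling off one base lowers \<open>t\<close> by one,
  so the point is \<open>t\<close> times a convex combination of base vectors. Nonemptiness supplies
  the point of the polytope needed at \<open>t = 0\<close>.\<close>

lemma lattice_points_in_dilation:
  assumes "rank2_bases cls \<noteq> {}" "f \<in> lattice_points t"
  shows "\<exists>x\<in>base_polytope (rank2_bases cls). (\<chi> k. real (f k)) = real t *\<^sub>R x"
  using assms(2)
proof (induction t arbitrary: f)
  case 0
  then have "sum f UNIV = 0" by (simp add: lattice_points_def compositions_def)
  then have "(\<chi> k. real (f k)) = real 0 *\<^sub>R x" for x :: "real ^ 'n"
    by (simp add: vec_eq_iff)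
  moreover have "base_polytope (rank2_bases cls) \<noteq> {}"
    using assms(1) by (simp add: base_polytope_def)
  ultimately show ?case by blast
next
  case (Suc t)
  let ?P = "base_polytope (rank2_bases cls)"
  obtain i j g where ij: "cls i \<noteq> cls j" and g: "g \<in> lattice_points t"
    and f: "\<forall>k. f k = g k + of_bool (k = i) + of_bool (k = j)"
    using Suc.prems by (rule lattice_points_Suc)
  obtain x where x: "x \<in> ?P" "(\<chi> k. real (g k)) = real t *\<^sub>R x"
    using Suc.IH[OF g] by blast
  define y :: "real ^ 'n" where "y = (\<Sum>k\<in>{i, j}. axis k 1)"
  have "y \<in> ?P"
    unfolding base_polytope_def y_def
    by (intro hull_inc imageI) (use ij in \<open>unfold rank2_bases_def, blast\<close>)
  have "convex ?P" by (simp add: base_polytope_def)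
  then have "(real t / (real t + 1)) *\<^sub>R x + (1 / (real t + 1)) *\<^sub>R y \<in> ?P"
    using x(1) \<open>y \<in> ?P\<close> by (intro convexD) (auto simp: field_simps)
  moreover have "(\<chi> k. real (f k)) =
      real (Suc t) *\<^sub>R ((real t / (real t + 1)) *\<^sub>R x + (1 / (real t + 1)) *\<^sub>R y)"
  proof -
    have "i \<noteq> j" using ij by auto
    then have "y $ k = of_bool (k = i) + of_bool (k = j)" for k
      unfolding y_def sum_axis_nth by simp
    then have "(\<chi> k. real (f k)) = (\<chi> k. real (g k)) + y"
      by (simp add: vec_eq_iff f)
    then show ?thesis
      by (simp add: x(2) scaleR_add_right add.commute)
  qed
  ultimately show ?case by blast
qed

lemma dilation_integer_points:
  assumes "rank2_bases cls \<noteq> {}"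
  shows "(\<lambda>x. real t *\<^sub>R x) ` base_polytope (rank2_bases cls) \<inter> integer_points =
    (\<lambda>f. \<chi> k. real (f k)) ` lattice_points t"
proof (intro equalityI subsetI)
  fix y assume "y \<in> (\<lambda>x. real t *\<^sub>R x) ` base_polytope (rank2_bases cls) \<inter> integer_points"
  then obtain x where x: "x \<in> base_polytope (rank2_bases cls)" and y: "y = real t *\<^sub>R x"
    and int: "\<And>k. y $ k \<in> \<int>"
    by (auto simp: integer_points_def)
  note c = base_polytope_constraints[OF x]
  have "y $ k \<in> \<nat>" for k
    using int[of k] c(1)[of k] by (simp add: y Nats_altdef2)
  then have "\<forall>k. \<exists>a. y $ k = real a" by (auto elim: Nats_cases)
  then obtain f where f: "\<And>k. y $ k = real (f k)" by metis
  have "real (sum f S) = real t * (\<Sum>k\<in>S. x $ k)" for S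
    by (simp add: f[symmetric] y sum_distrib_left)
  then have "real (sum f UNIV) = real (2 * t)" "\<And>v. v \<in> range cls \<Longrightarrow> real (sum f v) \<le> real t"
    using c mult_left_mono[of _ 1 "real t"] by auto
  then have "f \<in> lattice_points t"
    by (auto simp: lattice_points_def compositions_def simp del: of_nat_sum of_nat_mult)
  moreover have "y = (\<chi> k. real (f k))" by (simp add: f vec_eq_iff)
  ultimately show "y \<in> (\<lambda>f. \<chi> k. real (f k)) ` lattice_points t" by blast
next
  fix y assume "y \<in> (\<lambda>f. \<chi> k. real (f k)) ` lattice_points t"
  then show "y \<in> (\<lambda>x. real t *\<^sub>R x) ` base_polytope (rank2_bases cls) \<inter> integer_points"
    using lattice_points_in_dilation[OF assms] by (force simp: integer_points_def)
qed

lemma card_dilation_integer_points: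
  assumes "rank2_bases cls \<noteq> {}"
  shows "card ((\<lambda>x. real t *\<^sub>R x) ` base_polytope (rank2_bases cls) \<inter> integer_points) =
    card (lattice_points t)"
  unfolding dilation_integer_points[OF assms]
  by (intro card_image inj_onI) (auto simp: vec_eq_iff)

section \<open>Dimension of the base polytope\<close>

text \<open>\<open>axis i 1 - axis (r i) 1\<close> is the difference of the vertices of
  \<open>{i, j}\<close> and \<open>{r i, j}\<close> for some \<open>j\<close> outside both classes,
  hence a direction of the affine hull.\<close>

lemma affine_hull_directions:
  fixes V :: "(real ^ 'n) set"
  defines "V \<equiv> (\<lambda>B. \<Sum>i\<in>B. axis i 1) ` rank2_bases cls"
  assumes "finite I" "y \<in> affine hull V"
    and "\<And>i. i \<in> I \<Longrightarrow> \<exists>j. cls j \<noteq> cls i \<and> cls j \<noteq> cls (r i)"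
  shows "y + (\<Sum>i\<in>I. d i *\<^sub>R (axis i 1 - axis (r i) 1)) \<in> affine hull V"
  using assms(2,4)
proof (induction I rule: finite_induct)
  case empty
  then show ?case using assms(3) by simp
next
  case (insert i I)
  have edge: "axis a 1 + axis b 1 \<in> affine hull V" if "cls a \<noteq> cls b" for a b
  proof (rule hull_inc)
    have "(\<Sum>i\<in>{a, b}. axis i 1 :: real ^ 'n) \<in> V"
      using that unfolding V_def rank2_bases_def by blast
    moreover have "a \<noteq> b" using that by auto
    ultimately show "axis a 1 + axis b 1 \<in> V" by simp
  qed
  obtain j where "cls j \<noteq> cls i" "cls j \<noteq> cls (r i)" using insert.prems by blast
  then have "(y + (\<Sum>i\<in>I. d i *\<^sub>R (axis i 1 - axis (r i) 1))) + d i *\<^sub>R ((axis i 1 + axis j 1) - (axis (r i) 1 + axis j 1))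
      \<in> affine hull V"
    using insert by (intro mem_affine_3_minus edge) auto
  then show ?case using insert.hyps by (simp add: add_ac)
qed

text \<open>When \<open>d\<close> sums to 0 over every fibre of \<open>r\<close>, the combination
  has coordinates \<open>d\<close>; both dimension proofs use it in this way.\<close>

lemma sum_directions_nth:
  fixes d :: "'n \<Rightarrow> real"
  shows "(\<Sum>i\<in>UNIV. d i *\<^sub>R (axis i 1 - axis (r i) 1)) $ k = d k - (\<Sum>i\<in>{i. r i = k}. d i)"
proof -
  have "(d i *\<^sub>R (axis i 1 - axis (r i) 1)) $ k = (if i = k then d i else 0) - (if r i = k then d i else 0)" for i
    by (auto simp: axis_def)
  then have "(\<Sum>i\<in>UNIV. d i *\<^sub>R (axis i 1 - axis (r i) 1)) $ k =
      (\<Sum>i\<in>UNIV. (if i = k then d i else 0) - (if r i = k then d i else 0))"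
    by (simp only: sum_component)
  also have "\<dots> = d k - (\<Sum>i\<in>UNIV. if r i = k then d i else 0)"
    by (simp add: sum_subtractf)
  finally have "(\<Sum>i\<in>UNIV. d i *\<^sub>R (axis i 1 - axis (r i) 1)) $ k = \<dots>" .
  then show ?thesis by (simp add: sum.If_cases)
qed

text \<open>With a third class any two elements have a common partner, so one reference element
  \<open>i0\<close> serves all directions and the affine hull is the whole hyperplane of coordinate
  sum 2.\<close>

lemma aff_dim_base_polytope_ge_3:
  assumes "3 \<le> card (range cls)"
  shows "aff_dim (base_polytope (rank2_bases cls)) = int CARD('n) - 1"
proof -
  let ?V = "(\<lambda>B. \<Sum>i\<in>B. axis i (1::real)) ` rank2_bases cls"
  let ?H = "{x :: real ^ 'n. (\<chi> i. 1) \<bullet> x = 2}"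
  have third: "\<exists>j. cls j \<noteq> cls a \<and> cls j \<noteq> cls b" for a b
  proof (rule ccontr)
    assume "\<not> ?thesis"
    then have "range cls \<subseteq> {cls a, cls b}" by auto
    then have "card (range cls) \<le> card {cls a, cls b}" by (intro card_mono) auto
    also have "\<dots> \<le> 2" by (simp add: card_insert_if)
    finally show False using assms by simp
  qed
  fix i0 :: 'n
  obtain j0 where j0: "cls j0 \<noteq> cls i0" using third by blast
  define y :: "real ^ 'n" where "y = (\<Sum>i\<in>{i0, j0}. axis i 1)"
  have yV: "y \<in> ?V" using j0 unfolding y_def rank2_bases_def by blast
  have VH: "?V \<subseteq> ?H"
    using base_polytope_constraints(2)[of "_ :: real ^ 'n"] hull_subset[of ?V convex]
    by (auto simp: inner_vec_def base_polytope_def)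
  have "?H \<subseteq> affine hull ?V"
  proof
    fix x assume "x \<in> ?H"
    define d where "d i = x $ i - y $ i" for i
    have "y \<in> ?H" using VH yV by blast
    with \<open>x \<in> ?H\<close> have "sum d UNIV = 0" by (simp add: d_def inner_vec_def sum_subtractf)
    then have "(\<Sum>i\<in>UNIV. d i *\<^sub>R (axis i 1 - axis i0 1)) $ k = d k" for k
      using sum_directions_nth[of d "\<lambda>_. i0" k] by (cases "i0 = k") auto
    then have "x = y + (\<Sum>i\<in>UNIV. d i *\<^sub>R (axis i 1 - axis i0 1))"
      by (simp add: vec_eq_iff d_def)
    also have "\<dots> \<in> affine hull ?V"
      by (intro affine_hull_directions) (use yV third in \<open>auto intro: hull_inc\<close>)
    finally show "x \<in> affine hull ?V" .
  qed
  moreover have "affine hull ?V \<subseteq> ?H"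
    using VH by (intro hull_minimal affine_hyperplane)
  ultimately have "affine hull ?V = ?H" by blast
  then have "aff_dim ?V = aff_dim ?H" by (metis aff_dim_affine_hull)
  also have "\<dots> = int CARD('n) - 1"
    by (subst aff_dim_hyperplane) (auto simp: vec_eq_iff)
  finally show ?thesis by (simp add: base_polytope_def aff_dim_convex_hull)
qed

text \<open>With two classes only elements of the same class have a common partner, so each class
  gets its own reference element. The affine hull is where both class sums equal 1.\<close>

lemma aff_dim_base_polytope_2:
  assumes "card (range cls) = 2"
  shows "aff_dim (base_polytope (rank2_bases cls)) = int CARD('n) - 2"
proof -
  let ?V = "(\<lambda>B. \<Sum>i\<in>B. axis i (1::real)) ` rank2_bases cls"
  let ?H = "\<lambda>v. {x :: real ^ 'n. (\<chi> i. of_bool (i \<in> v)) \<bullet> x = 1}"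
  obtain v w where vw: "range cls = {v, w}" "v \<noteq> w" using assms by (meson card_2_iff)
  then obtain i0 j0 where ij: "cls i0 = v" "cls j0 = w" by (metis insertI1 insertI2 rangeE)
  have cases: "cls i = v \<or> cls i = w" for i
    using vw(1) rangeI[of cls i] by simp
  have inner: "(\<chi> i. of_bool (i \<in> S)) \<bullet> x = (\<Sum>i\<in>S. x $ i)" for S and x :: "real ^ 'n"
    by (simp add: inner_vec_def sum_of_bool_mult_eq)
  define y :: "real ^ 'n" where "y = (\<Sum>i\<in>{i0, j0}. axis i 1)"
  have yV: "y \<in> ?V" unfolding y_def by (intro imageI rank2_basesI) (simp add: ij vw(2))
  have VH: "?V \<subseteq> ?H v \<inter> ?H w"
  proof
    fix x assume "x \<in> ?V"
    then have "x \<in> base_polytope (rank2_bases cls)"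
      unfolding base_polytope_def by (rule hull_inc)
    note c = base_polytope_constraints[OF this]
    \<comment> \<open>Two class sums of at most 1 with total 2 must both be 1.\<close>
    have "(\<Sum>i\<in>v. x $ i) + (\<Sum>i\<in>w. x $ i) = 2"
      using sum_classes[of "\<lambda>i. x $ i"] c(2) vw(2) unfolding vw(1) by simp
    moreover have "(\<Sum>i\<in>v. x $ i) \<le> 1" "(\<Sum>i\<in>w. x $ i) \<le> 1" using c(3) unfolding vw(1) by auto
    ultimately show "x \<in> ?H v \<inter> ?H w" by (simp add: inner)
  qed
  have "?H v \<inter> ?H w \<subseteq> affine hull ?V"
  proof
    fix x assume x: "x \<in> ?H v \<inter> ?H w"
    define d where "d i = x $ i - y $ i" for i
    define r where "r i = (if cls i = v then i0 else j0)" for i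
    have "y \<in> ?H v \<inter> ?H w" using VH yV by (rule subsetD)
    with x have d: "sum d v = 0" "sum d w = 0" by (simp_all add: d_def inner sum_subtractf)
    have mem: "i \<in> v \<longleftrightarrow> cls i = v" "i \<in> w \<longleftrightarrow> cls i \<noteq> v" for i
      using mem_cls_iff[of i i0] mem_cls_iff[of i j0] ij vw(2) cases[of i] by auto
    have "i0 \<noteq> j0" using ij vw(2) by auto
    then have "{i. r i = k} = (if k = i0 then v else if k = j0 then w else {})" for k
      by (intro set_eqI) (simp add: r_def mem)
    then have "(\<Sum>i\<in>UNIV. d i *\<^sub>R (axis i 1 - axis (r i) 1)) $ k = d k" for k
      using d unfolding sum_directions_nth by simp
    then have "x = y + (\<Sum>i\<in>UNIV. d i *\<^sub>R (axis i 1 - axis (r i) 1))"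
      by (simp add: vec_eq_iff d_def)
    also have "\<dots> \<in> affine hull ?V"
    proof (intro affine_hull_directions)
      fix i
      show "\<exists>j. cls j \<noteq> cls i \<and> cls j \<noteq> cls (r i)"
        using ij vw(2) cases[of i] unfolding r_def by (cases "cls i = v") (auto intro: exI[of _ i0] exI[of _ j0])
    qed (use yV in \<open>auto intro: hull_inc\<close>)
    finally show "x \<in> affine hull ?V" .
  qed
  moreover have "affine hull ?V \<subseteq> ?H v \<inter> ?H w"
    using VH by (intro hull_minimal affine_Int affine_hyperplane)
  ultimately have hull: "affine hull ?V = ?H v \<inter> ?H w" by (rule antisym[rotated])
  \<comment> \<open>\<open>axis i0 1\<close> lies on the first hyperplane but not on the second, so
    intersecting lowers the dimension by exactly one.\<close>
  have "i0 \<in> v" "i0 \<notin> w" using ij vw(2) mem_cls_iff[of i0 i0] mem_cls_iff[of i0 j0] by auto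
  then have "axis i0 1 \<in> ?H v" "axis i0 1 \<notin> ?H w"
    by (simp_all add: inner axis_def)
  then have nsub: "\<not> ?H v \<subseteq> ?H w" by (meson subsetD)
  have ne: "?H v \<inter> ?H w \<noteq> {}" using subsetD[OF VH yV] by (metis empty_iff)
  have "aff_dim (?H v \<inter> ?H w) = aff_dim (?H v) - 1"
    by (rule trans[OF aff_dim_affine_Int_hyperplane[OF affine_hyperplane]
          trans[OF if_not_P[OF ne] if_not_P[OF nsub]]])
  also have "aff_dim (?H v) = int CARD('n) - 1"
    using \<open>i0 \<in> v\<close> by (subst aff_dim_hyperplane) (auto simp: vec_eq_iff)
  finally have "aff_dim ?V = int CARD('n) - 2" by (metis aff_dim_affine_hull hull diff_diff_eq one_add_one)
  then show ?thesis by (simp add: base_polytope_def aff_dim_convex_hull)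
qed

section \<open>Counting lattice points by inclusion-exclusion\<close>

lemma cls_small_cases:
  assumes "\<And>i. card (cls i) \<le> 2" "v \<in> range cls"
  obtains i where "v = {i}" | i j where "v = {i, j}" "i \<noteq> j"
proof -
  obtain i where i: "v = cls i" using assms(2) by (rule rangeE)
  have "i \<in> v" using self_mem_cls i by simp
  then have "card v \<noteq> 0" by auto
  moreover have "card v \<le> 2" using assms(1) i by simp
  ultimately have "card v = 1 \<or> card v = 2" by linarith
  then show thesis using that by (auto simp: card_1_singleton_iff card_2_iff)
qed

lemma card_UNIV_eq_classes:
  assumes "\<And>i. card (cls i) \<le> 2"
  shows "CARD('n) = card (range cls) + card {v \<in> range cls. card v = 2}"
proof -
  have "CARD('n) = (\<Sum>v\<in>range cls. card v)"
    using sum_classes[of "\<lambda>_. 1::nat"] by simp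
  also have "\<dots> = (\<Sum>v\<in>range cls. 1 + of_bool (card v = 2))"
  proof (rule sum.cong[OF refl])
    fix v assume "v \<in> range cls"
    with assms show "card v = 1 + of_bool (card v = 2)"
      by (cases rule: cls_small_cases) simp_all
  qed
  also have "\<dots> = card (range cls) + card {v \<in> range cls. card v = 2}"
    by (simp only: sum.distrib sum_of_bool_eq_card[OF finite]) simp
  finally show ?thesis .
qed

lemma card_heavy_class:
  assumes small: "\<And>i. card (cls i) \<le> 2" and "2 \<le> card (range cls)" "v \<in> range cls"
  shows "card {f \<in> compositions UNIV (2 * t). t < sum f v} = ((t + CARD('n) - 2) choose (CARD('n) - 1)) +
    of_bool (card v = 2) * ((t + 1) * ((t + CARD('n) - 3) choose (CARD('n) - 2)))"
  using small assms(3)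
proof (cases rule: cls_small_cases)
  case (1 i)
  have "card {f \<in> compositions UNIV (2 * t). t + 1 \<le> f i} = (t + CARD('n) - 2) choose (CARD('n) - 1)"
    using card_UNIV_eq_classes[OF small] assms(2) by (intro card_compositions_ge) simp_all
  then show ?thesis by (simp add: 1 Suc_le_eq)
next
  case (2 i j)
  \<comment> \<open>A two-element class next to another class forces at least three elements, as the
    count for pairs requires.\<close>
  have "v \<in> {v \<in> range cls. card v = 2}" using assms(3) 2 by simp
  then have "card {v \<in> range cls. card v = 2} \<noteq> 0" by auto
  then have "3 \<le> CARD('n)"
    using card_UNIV_eq_classes[OF small] assms(2) by linarith
  then show ?thesis
    using card_compositions_pair_gt[of UNIV i j t] 2 by simp
qed

text \<open>Inclusion-exclusion stops after one step, since two classes of weight above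
  \<open>t\<close> would exceed the total \<open>2 * t\<close>. The identity is additive to avoid
  truncated subtraction.\<close>

lemma card_lattice_points:
  assumes small: "\<And>i. card (cls i) \<le> 2" and "2 \<le> card (range cls)"
  shows "card (lattice_points t) + card (range cls) * ((t + CARD('n) - 2) choose (CARD('n) - 1)) +
      card {v \<in> range cls. card v = 2} * ((t + 1) * ((t + CARD('n) - 3) choose (CARD('n) - 2))) =
    (2 * t + CARD('n) - 1) choose (CARD('n) - 1)"
proof -
  let ?C = "compositions (UNIV :: 'n set) (2 * t)"
  let ?W = "\<lambda>v. {f \<in> ?C. t < sum f v}"
  have fin: "finite ?C" by (simp add: finite_compositions)
  have disj: "?W v \<inter> ?W w = {}" if "v \<in> range cls" "w \<in> range cls" "v \<noteq> w" for v w
  proof -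
    have "sum f v + sum f w \<le> 2 * t" if "f \<in> ?C" for f
    proof -
      have "sum f v + sum f w = (\<Sum>u\<in>{v, w}. sum f u)"
        using \<open>v \<noteq> w\<close> by simp
      also have "\<dots> \<le> (\<Sum>u\<in>range cls. sum f u)"
        using \<open>v \<in> range cls\<close> \<open>w \<in> range cls\<close> by (intro sum_mono2) simp_all
      finally show ?thesis using that by (simp add: sum_classes compositions_def)
    qed
    then show ?thesis by fastforce
  qed
  have "?C = lattice_points t \<union> (\<Union>v\<in>range cls. ?W v)"
    by (auto simp: lattice_points_def not_le)
  moreover have "card (lattice_points t \<union> (\<Union>v\<in>range cls. ?W v)) =
      card (lattice_points t) + card (\<Union>v\<in>range cls. ?W v)"
  proof (rule card_Un_disjoint)
    show "finite (lattice_points t)"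
      by (rule finite_subset[OF _ fin]) (auto simp: lattice_points_def)
    show "lattice_points t \<inter> (\<Union>v\<in>range cls. ?W v) = {}"
      by (auto simp: lattice_points_def not_less[symmetric])
  qed (simp add: fin)
  moreover have "card (\<Union>v\<in>range cls. ?W v) = (\<Sum>v\<in>range cls. card (?W v))"
    using disj fin by (intro card_UN_disjoint) simp_all
  moreover have "(\<Sum>v\<in>range cls. card (?W v)) =
      (\<Sum>v\<in>range cls. ((t + CARD('n) - 2) choose (CARD('n) - 1)) +
        of_bool (card v = 2) * ((t + 1) * ((t + CARD('n) - 3) choose (CARD('n) - 2))))"
    by (intro sum.cong refl card_heavy_class assms)
  moreover have "\<dots> = card (range cls) * ((t + CARD('n) - 2) choose (CARD('n) - 1)) +
      card {v \<in> range cls. card v = 2} * ((t + 1) * ((t + CARD('n) - 3) choose (CARD('n) - 2)))"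
    by (simp only: sum.distrib sum_distrib_right[symmetric] sum_of_bool_eq_card[OF finite]) simp
  moreover have "card ?C = (2 * t + CARD('n) - 1) choose (CARD('n) - 1)"
  proof -
    obtain k where k: "CARD('n) = Suc k" using zero_less_card_finite gr0_conv_Suc by blast
    then show ?thesis
      using binomial_symmetric[of "2 * t" "2 * t + k"] by (simp add: card_compositions)
  qed
  ultimately show ?thesis by (simp only: add_ac)
qed

section \<open>Ehrhart positivity for given parallel classes\<close>

lemma scaled_ehrhart_eval:
  assumes small: "\<And>i. card (cls i) \<le> 2" and two: "2 \<le> card (range cls)"
  defines "m \<equiv> CARD('n) - 2" and "l \<equiv> card {v \<in> range cls. card v = 2}"
  shows "poly (smult (1 / fact (Suc m)) (scaled_ehrhart m l)) (real t) = real (card (lattice_points t))"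
proof -
  have n: "CARD('n) = m + 2" "card (range cls) + l = m + 2"
    using card_UNIV_eq_classes[OF small] two by (simp_all add: m_def l_def)
  have "real ((t + m) choose Suc m) * fact (Suc m) = pochhammer (real t) m * (real t + real m)"
    using binomial_mult_fact_eq_pochhammer[of t m] by (simp add: pochhammer_Suc del: fact_Suc)
  moreover have "real ((2 * t + Suc m) choose Suc m) * fact (Suc m) = pochhammer (2 * real t + 1) (Suc m)"
    using binomial_mult_fact_eq_pochhammer[of "2 * t + 1" m] by (simp add: add_ac del: fact_Suc)
  moreover have "real l * (real ((t + m - 1) choose m) * fact (Suc m)) = real l * (pochhammer (real t) m * (real m + 1))"
  proof (cases m)
    \<comment> \<open>Two elements in at least two classes leave no two-element class, so
      \<open>l = 0\<close>.\<close>
    case 0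
    then show ?thesis using n two by simp
  next
    case (Suc k)
    then show ?thesis
      using binomial_mult_fact_eq_pochhammer[of t k] by simp
  qed
  moreover have "real (card (lattice_points t)) + real (card (range cls)) * real ((t + m) choose Suc m) +
      real l * ((real t + 1) * real ((t + m - 1) choose m)) = real ((2 * t + Suc m) choose Suc m)"
  proof -
    have "t + CARD('n) - 2 = t + m" "CARD('n) - 1 = Suc m" "t + CARD('n) - 3 = t + m - 1"
      "CARD('n) - 2 = m" "2 * t + CARD('n) - 1 = 2 * t + Suc m"
      using n(1) by simp_all
    then have "card (lattice_points t) + card (range cls) * ((t + m) choose Suc m) +
        l * ((t + 1) * ((t + m - 1) choose m)) = (2 * t + Suc m) choose Suc m"
      using card_lattice_points[OF small two, of t] by (simp only: l_def)
    from arg_cong[OF this, of real] show ?thesis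
      by (simp only: of_nat_add of_nat_mult of_nat_1)
  qed
  moreover have "real (card (range cls)) = real m + 2 - real l"
    using n(2) by linarith
  ultimately have "fact (Suc m) * real (card (lattice_points t)) = poly (scaled_ehrhart m l) (real t)"
    unfolding poly_scaled_ehrhart by (rule count_identity)
  then show ?thesis by (simp add: field_simps del: fact_Suc)
qed

theorem ehrhart_positive_rank2_bases:
  assumes small: "\<And>i. card (cls i) \<le> 2" and two: "2 \<le> card (range cls)"
  shows "ehrhart_positive (rank2_bases cls)"
proof -
  define m where "m = CARD('n) - 2"
  define l where "l = card {v \<in> range cls. card v = 2}"
  define p where "p = smult (1 / fact (Suc m)) (scaled_ehrhart m l)"
  let ?P = "base_polytope (rank2_bases cls)"
  let ?d = "if l < m then Suc m else m"
  have n: "CARD('n) = m + 2" "card (range cls) + l = m + 2"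
    using card_UNIV_eq_classes[OF small] two by (simp_all add: m_def l_def)
  have "l \<le> card (range cls)"
    unfolding l_def by (intro card_mono) auto
  \<comment> \<open>The number of classes is \<open>m + 2 - l\<close>; it is at least
    \<open>l\<close> and at least 2.\<close>
  then have l: "2 * l \<le> m + 2" "l \<le> m" using n two by linarith+
  have "rank2_bases cls \<noteq> {}"
  proof -
    have "\<not> range cls \<subseteq> {cls i}" for i
      using two card_mono[of "{cls i}" "range cls"] by auto
    then obtain j where "cls undefined \<noteq> cls j" by fastforce
    then show ?thesis using rank2_basesI by fast
  qed
  then have "poly p (real t) = real (card ((\<lambda>x. real t *\<^sub>R x) ` ?P \<inter> integer_points))" for t
    unfolding p_def m_def l_def scaled_ehrhart_eval[OF small two]
    by (simp only: card_dilation_integer_points simp_thms)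
  \<comment> \<open>\<open>l < m\<close> says exactly that there are at least three classes.\<close>
  moreover have dim: "aff_dim ?P = int ?d"
  proof (cases "l < m")
    case True
    then show ?thesis using n by (subst aff_dim_base_polytope_ge_3) simp_all
  next
    case False
    then show ?thesis using n l by (subst aff_dim_base_polytope_2) simp_all
  qed
  moreover have "degree p = ?d"
    using scaled_ehrhart_pos(1)[OF l] by (simp add: p_def del: fact_Suc)
  ultimately have "is_ehrhart_poly ?P p" by (simp add: is_ehrhart_poly_def)
  moreover have "0 < coeff p i" if "int i \<le> aff_dim ?P" for i
    using scaled_ehrhart_pos(2)[OF l, of i] that unfolding dim p_def by (simp del: fact_Suc)
  ultimately show ?thesis
    by (simp add: ehrhart_positive_def ehrhart_poly_eqI)
qed

end

subsection \<open>Sparse paving matroids of rank 2\<close>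

text \<open>A dependent set contains a minimal dependent one, which is a circuit and so has at least
  as many elements as the rank.\<close>

lemma paving_imp_indep:
  assumes "paving E \<B>" "finite E" "X \<subseteq> E" "card X < matroid_rank \<B>"
  shows "matroid_indep \<B> X"
proof (rule ccontr)
  assume dep: "\<not> matroid_indep \<B> X"
  have "finite X" using assms finite_subset by blast
  let ?A = "{D \<in> Pow X. \<not> matroid_indep \<B> D}"
  obtain D where D: "D \<in> ?A" and min: "\<And>D'. D' \<in> ?A \<Longrightarrow> D' \<subseteq> D \<Longrightarrow> D = D'"
    using finite_has_minimal[of ?A] \<open>finite X\<close> dep by auto
  have "matroid_circuit E \<B> D"
    unfolding matroid_circuit_def using D min assms(3) by blast
  then have "matroid_rank \<B> \<le> card D"
    using assms(1) by (simp add: paving_def)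
  also have "\<dots> \<le> card X" using D \<open>finite X\<close> by (simp add: card_mono)
  finally show False using assms(4) by simp
qed

text \<open>In rank 2 the singleton \<open>{i, i}\<close> is not a base, so \<open>i\<close> lies in
  its own class.\<close>

definition parallel_class :: "'a set set \<Rightarrow> 'a \<Rightarrow> 'a set" where
  "parallel_class \<B> i = {j. {i, j} \<notin> \<B>}"

locale sparse_paving_rank2 = matroid "UNIV :: 'n::finite set" \<B> for \<B> +
  assumes sparse: "sparse_paving UNIV \<B>" and rank: "matroid_rank \<B> = 2"
begin

lemma card_base: "B \<in> \<B> \<Longrightarrow> card B = 2"
  using matroid_rank_eq rank by simp

text \<open>There are no loops: in rank 2, paving makes every singleton independent.\<close>

lemma base_through: "\<exists>l. {i, l} \<in> \<B>"
proof -
  have "matroid_indep \<B> {i}"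
    using sparse rank by (intro paving_imp_indep[of UNIV]) (simp_all add: sparse_paving_def)
  then obtain B where B: "B \<in> \<B>" "i \<in> B" by (auto simp: matroid_indep_def)
  then obtain a b where "B = {a, b}" using card_base by (meson card_2_iff)
  with B show ?thesis by (auto simp: insert_commute)
qed

text \<open>Dual paving enters here: the complement of \<open>T\<close> has \<open>n - 3\<close>
  elements, below the dual rank \<open>n - 2\<close>, so it is disjoint from some base, which then
  lies in \<open>T\<close>.\<close>

lemma base_in_triple:
  assumes "card T = 3"
  shows "\<exists>B\<in>\<B>. B \<subseteq> T"
proof -
  have "card (- B) = CARD('n) - 2" if "B \<in> \<B>" for B
    using card_base[OF that] by (simp add: Compl_eq_Diff_UNIV card_Diff_subset)
  then have "card ` dual_bases UNIV \<B> = {CARD('n) - 2}"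
    using bases_nonempty by (auto simp: dual_bases_def image_image Compl_eq_Diff_UNIV[symmetric])
  then have "matroid_rank (dual_bases UNIV \<B>) = CARD('n) - 2"
    by (simp add: matroid_rank_def)
  moreover have "card (- T) = CARD('n) - 3" "3 \<le> CARD('n)"
    using assms card_mono[of UNIV T] by (simp_all add: Compl_eq_Diff_UNIV card_Diff_subset)
  ultimately have "matroid_indep (dual_bases UNIV \<B>) (- T)"
    using sparse by (intro paving_imp_indep[of UNIV]) (simp_all add: sparse_paving_def)
  then show ?thesis by (auto simp: matroid_indep_def dual_bases_def)
qed

text \<open>Exchanging \<open>l\<close> out of a base \<open>{i, l}\<close> against
  \<open>{j, k}\<close> would put \<open>i\<close> into a base with \<open>j\<close> or
  \<open>k\<close>.\<close>

lemma parallel_trans: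
  assumes "{i, j} \<notin> \<B>" "{i, k} \<notin> \<B>"
  shows "{j, k} \<notin> \<B>"
proof
  assume jk: "{j, k} \<in> \<B>"
  obtain l where l: "{i, l} \<in> \<B>" using base_through by blast
  then have "l \<noteq> i" using card_base[OF l] by auto
  then have "{i, l} - {l} = {i}" by auto
  moreover have "l \<in> {i, l} - {j, k}" using l assms by auto
  ultimately obtain b where "b \<in> {j, k} - {i, l}" "insert b {i} \<in> \<B>"
    using exchange[OF l jk, of l] by auto
  then show False using assms by (auto simp: insert_commute)
qed

lemma self_mem_parallel_class: "i \<in> parallel_class \<B> i"
  using card_base[of "{i}"] by (auto simp: parallel_class_def)

lemma parallel_sym: "{j, i} \<in> \<B> \<longleftrightarrow> {i, j} \<in> \<B>"
  by (simp add: insert_commute)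

lemma mem_parallel_class_iff: "j \<in> parallel_class \<B> i \<longleftrightarrow> parallel_class \<B> j = parallel_class \<B> i"
proof
  assume "j \<in> parallel_class \<B> i"
  then have ij: "{i, j} \<notin> \<B>" "{j, i} \<notin> \<B>" by (simp_all add: parallel_class_def parallel_sym)
  have "{j, k} \<notin> \<B> \<longleftrightarrow> {i, k} \<notin> \<B>" for k
    using parallel_trans[OF ij(1)] parallel_trans[OF ij(2)] by metis
  then show "parallel_class \<B> j = parallel_class \<B> i" by (simp add: parallel_class_def)
next
  assume "parallel_class \<B> j = parallel_class \<B> i"
  then show "j \<in> parallel_class \<B> i" using self_mem_parallel_class[of j] by simp
qed

sublocale parallel_classes "parallel_class \<B>"
  by unfold_locales (rule mem_parallel_class_iff)

text \<open>Three elements of one class would contain a base by \<open>base_in_triple\<close>, which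
  \<open>parallel_trans\<close> forbids.\<close>

lemma card_parallel_class_le: "card (parallel_class \<B> i) \<le> 2"
proof (rule ccontr)
  assume "\<not> ?thesis"
  then have "3 \<le> card (parallel_class \<B> i)" by simp
  then obtain T where T: "T \<subseteq> parallel_class \<B> i" "card T = 3"
    by (rule obtain_subset_with_card_n)
  obtain B where B: "B \<in> \<B>" "B \<subseteq> T" using base_in_triple[OF T(2)] by blast
  then obtain a b where ab: "B = {a, b}" using card_base by (meson card_2_iff)
  then have "{i, a} \<notin> \<B>" "{i, b} \<notin> \<B>" using B(2) T(1) by (auto simp: parallel_class_def)
  then show False using parallel_trans B(1) ab by blast
qed

lemma base_iff: "{i, j} \<in> \<B> \<longleftrightarrow> parallel_class \<B> i \<noteq> parallel_class \<B> j"
  using mem_parallel_class_iff[of j i] by (auto simp: parallel_class_def)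

lemma bases_eq: "rank2_bases (parallel_class \<B>) = \<B>"
proof (rule set_eqI)
  fix B
  have "B \<in> \<B> \<longleftrightarrow> (\<exists>i j. B = {i, j} \<and> {i, j} \<in> \<B>)"
    using card_base by (metis card_2_iff)
  then show "B \<in> rank2_bases (parallel_class \<B>) \<longleftrightarrow> B \<in> \<B>"
    by (simp only: rank2_bases_def mem_Collect_eq base_iff)
qed

lemma two_parallel_classes: "2 \<le> card (range (parallel_class \<B>))"
proof -
  fix i :: 'n
  obtain j where "{i, j} \<in> \<B>" using base_through by blast
  then have "parallel_class \<B> i \<noteq> parallel_class \<B> j" by (simp only: base_iff simp_thms)
  then have "2 = card {parallel_class \<B> i, parallel_class \<B> j}" by simp
  also have "\<dots> \<le> card (range (parallel_class \<B>))" by (intro card_mono) simp_all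
  finally show ?thesis .
qed

end

theorem corollary7p2:
  fixes \<B> :: "'n::finite set set"
  assumes "matroid (UNIV :: 'n set) \<B>"
    and "sparse_paving (UNIV :: 'n set) \<B>"
    and "matroid_rank \<B> = 2"
  shows "ehrhart_positive \<B>"
proof -
  interpret sparse_paving_rank2 \<B>
    using assms by (intro sparse_paving_rank2.intro sparse_paving_rank2_axioms.intro)
  show ?thesis
    using ehrhart_positive_rank2_bases[OF card_parallel_class_le two_parallel_classes]
    by (simp only: bases_eq)
qed

end
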